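(* Let $(\ell,\mathcal{Z},\mathcal{F})$ be a game satisfying the standing assumptions below, with $\ell$ of the piecewise linear form described there. Suppose that $\mathcal{F}$ is a polyhedron, and that at least one of the following holds: (1) $\mathcal{Z}$ has finite cardinality; (2) $\ell(\cdot,f)$ is continuous on $\mathcal{Z}$ for every $f\in\mathcal{F}$. Then either the game $(\ell,\mathcal{Z},\mathcal{F})$ is trivial, or $R_T(\ell,\mathcal{Z},\mathcal{F})=\Omega(\sqrt{T})$, i.e. there exist $c>0$ and $T_0$ such that $R_T(\ell,\mathcal{Z},\mathcal{F})\ge c\sqrt{T}$ for all integers $T\ge T_0$.
   Context: Standing assumptions: $\mathcal{Z}\subset\mathbb{R}^{d_z}$ is non-empty and compact; $\mathcal{F}\subset\mathbb{R}^{d_f}$ is non-empty, convex and compact. The loss $\ell:\mathcal{Z}\times\mathcal{F}\to\mathbb{R}$ is bounded and has the form $$\ell(z,f)=\max_{x\in\mathcal{X}(z)}(C(z)f+c(z))^{\mathsf T}x,$$ where for each $z\in\mathcal{Z}$, $C(z)$ is a matrix, $c(z)$ is a vector, and $\mathcal{X}(z)\subset\mathbb{R}^d$ is a non-empty set that is either finite or a polyhedron $\{x\in\mathbb{R}^d \mid A(z)x\le b(z)\}$ for a matrix $A(z)$ and a vector $b(z)$. Value of the game: for an integer $T\ge1$, $$R_T(\ell,\mathcal{Z},\mathcal{F})=\inf_{f_1\in\mathcal{F}}\sup_{z_1\in\mathcal{Z}}\cdots\inf_{f_T\in\mathcal{F}}\sup_{z_T\in\mathcal{Z}}\Big[\sum_{t=1}^T\ell(z_t,f_t)-\inf_{f\in\mathcal{F}}\sum_{t=1}^T\ell(z_t,f)\Big].$$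 Trivial game: $(\ell,\mathcal{Z},\mathcal{F})$ is trivial if there exists $f^*\in\mathcal{F}$ such that $\ell(z,f^* )\le\min_{f\in\mathcal{F}}\ell(z,f)$ for all $z\in\mathcal{Z}$. *)

theory Defs
  imports "HOL-Analysis.Analysis"
begin

definition is_maximum :: "real set \<Rightarrow> real \<Rightarrow> bool" where
  "is_maximum S m \<longleftrightarrow> m \<in> S \<and> (\<forall>y\<in>S. y \<le> m)"

text \<open>
  \<open>game_value l Z F k h\<close> is the value of the remaining \<open>k\<close> rounds after the list \<open>h\<close> of moves
  \<open>(z\<^sub>t, f\<^sub>t)\<close>, in the order played. The infima and suprema are taken in the reals; they are the
  intended ones when \<open>l\<close> is bounded on \<open>Z \<times> F\<close> and both sets are non-empty.
\<close>

fun game_value ::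
  "('z \<Rightarrow> 'f \<Rightarrow> real) \<Rightarrow> 'z set \<Rightarrow> 'f set \<Rightarrow> nat \<Rightarrow> ('z \<times> 'f) list \<Rightarrow> real" where
  "game_value l Z F 0 h =
     (\<Sum>(z, f)\<leftarrow>h. l z f) - (INF f\<in>F. \<Sum>(z, _)\<leftarrow>h. l z f)"
| "game_value l Z F (Suc k) h =
     (INF f\<in>F. SUP z\<in>Z. game_value l Z F k (h @ [(z, f)]))"

definition minimax_regret ::
  "('z \<Rightarrow> 'f \<Rightarrow> real) \<Rightarrow> 'z set \<Rightarrow> 'f set \<Rightarrow> nat \<Rightarrow> real" where
  "minimax_regret l Z F T = game_value l Z F T []"

definition trivial_game :: "('z \<Rightarrow> 'f \<Rightarrow> real) \<Rightarrow> 'z set \<Rightarrow> 'f set \<Rightarrow> bool" where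
  "trivial_game l Z F \<longleftrightarrow> (\<exists>fstar\<in>F. \<forall>z\<in>Z. l z fstar \<le> (INF f\<in>F. l z f))"

end

theory Submission
  imports Defs
begin

text \<open>
  If some distribution \<open>p\<close> on finitely many moves has two minimisers \<open>f1\<close>, \<open>f2\<close> of the expected loss
  whose losses differ on the support, an adversary drawing independently from \<open>p\<close> forces regret of
  order \<open>sqrt T\<close>: the better of the two comparators beats the mean by half of the absolute value of
  a centred random walk. Suppose there is no such \<open>p\<close>, and fix a finite set \<open>W\<close> of moves. Since the
  losses are piecewise linear, minimisers can be chosen from a finite set of points, so moving the
  weights along a segment splits it into finitely many closed sets, disjoint for points with
  different losses; by connectedness one point minimises every positively weighted loss, hence, in
  the limit, each of the losses in \<open>W\<close>. The sets of minimisers thus have the finite intersection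
  property, and compactness of \<open>F\<close> yields a common minimiser.
\<close>

section \<open>Boundedness of the game value\<close>

lemma abs_sum_list_le:
  fixes g :: "'a \<Rightarrow> real"
  assumes "\<And>x. x \<in> set xs \<Longrightarrow> \<bar>g x\<bar> \<le> B"
  shows "\<bar>sum_list (map g xs)\<bar> \<le> B * real (length xs)"
  using assms
proof (induction xs)
  case (Cons x xs)
  have "\<bar>g x\<bar> \<le> B" "\<bar>sum_list (map g xs)\<bar> \<le> B * real (length xs)"
    using Cons by auto
  then show ?case by (simp add: algebra_simps)
qed simp

text \<open>Each round contributes at most \<open>B\<close> in absolute value to the learner's loss
  and at most \<open>B\<close> to the comparator's. The bound is what lets the real supremum over
  \<open>Z\<close> act as an upper bound for each single move.\<close>

lemma abs_game_value_le:
  fixes l :: "'z \<Rightarrow> 'f \<Rightarrow> real"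
  assumes "Z \<noteq> {}" "F \<noteq> {}"
    and B: "\<And>z f. z \<in> Z \<Longrightarrow> f \<in> F \<Longrightarrow> \<bar>l z f\<bar> \<le> B"
    and "set h \<subseteq> Z \<times> F"
  shows "\<bar>game_value l Z F k h\<bar> \<le> 2 * B * (real (length h) + real k)"
  using assms(4)
proof (induction k arbitrary: h)
  case 0
  have "\<bar>\<Sum>(z, f)\<leftarrow>h. l z f\<bar> \<le> B * real (length h)"
    using 0 B by (intro abs_sum_list_le) auto
  moreover have "\<bar>INF f\<in>F. \<Sum>(z, _)\<leftarrow>h. l z f\<bar> \<le> B * real (length h)"
  proof (rule cInf_abs_ge)
    fix y assume "y \<in> (\<lambda>f. \<Sum>(z, _)\<leftarrow>h. l z f) ` F"
    then obtain f where "f \<in> F" and y: "y = (\<Sum>(z, _)\<leftarrow>h. l z f)" by blast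
    show "\<bar>y\<bar> \<le> B * real (length h)"
      unfolding y using 0 B \<open>f \<in> F\<close> by (intro abs_sum_list_le) auto
  qed (use assms in auto)
  ultimately show ?case by simp
next
  case (Suc k)
  let ?M = "2 * B * (real (length h) + real (Suc k))"
  have gv: "\<bar>game_value l Z F k (h @ [(z, f)])\<bar> \<le> ?M" if "z \<in> Z" "f \<in> F" for z f
    using Suc.IH[of "h @ [(z, f)]"] Suc.prems that by (simp add: algebra_simps)
  have "\<bar>SUP z\<in>Z. game_value l Z F k (h @ [(z, f)])\<bar> \<le> ?M" if "f \<in> F" for f
    by (rule cSup_abs_le) (use gv that assms(1) in auto)
  then have "\<bar>INF f\<in>F. SUP z\<in>Z. game_value l Z F k (h @ [(z, f)])\<bar> \<le> ?M"
    by (intro cInf_abs_ge) (use assms(2) in auto)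
  then show ?case by simp
qed

section \<open>A quartic potential for centred random walks\<close>

text \<open>
  \<open>regret_potential s v m3 m4 k x\<close> is the expectation of
  \<open>(x + D)\<^sup>2 / s - (x + D)^4 / (4 * s ^ 3)\<close> where \<open>D\<close> is a sum of \<open>k\<close> independent copies of a
  centred random variable with moments \<open>v\<close>, \<open>m3\<close>, \<open>m4\<close>.
\<close>

definition regret_potential ::
  "real \<Rightarrow> real \<Rightarrow> real \<Rightarrow> real \<Rightarrow> nat \<Rightarrow> real \<Rightarrow> real" where
  "regret_potential s v m3 m4 k x =
     (x^2 + real k * v) / s
     - (x^4 + 6 * x^2 * real k * v + 4 * x * real k * m3 + real k * m4
          + 3 * real k * (real k - 1) * v^2) / (4 * s^3)"

text \<open>With \<open>u = \<bar>x\<bar> / s\<close> this is \<open>u^2 - u^4 / 4 \<le> u\<close>,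
  a cubic inequality after dividing by \<open>u\<close>. A polynomial minorant of the absolute value
  is wanted because its expectation along a random walk depends only on finitely many moments of the
  steps.\<close>

lemma regret_potential_0_le_abs:
  assumes "s > 0"
  shows "regret_potential s v m3 m4 0 x \<le> \<bar>x\<bar>"
proof -
  define u where "u = \<bar>x\<bar> / s"
  have u: "u \<ge> 0" "\<bar>x\<bar> = s * u" using assms by (auto simp: u_def)
  have "0 \<le> 1 - u + u^3 / 4"
  proof (cases "u \<le> 2")
    case True
    have "1 - u + u^3 / 4 = ((u - 1)^2 * (u + 2) + (2 - u)) / 4"
      by (simp add: field_simps power2_eq_square power3_eq_cube)
    also have "\<dots> \<ge> 0" using True u(1) by (intro divide_nonneg_pos add_nonneg_nonneg) auto
    finally show ?thesis .
  next
    case False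
    then have "u * 4 \<le> u * u^2"
      using power_mono[of 2 u 2] by (intro mult_left_mono) auto
    then show ?thesis by (simp add: power3_eq_cube power2_eq_square)
  qed
  then have "0 \<le> s * u * (1 - u + u^3 / 4)"
    using u assms by simp
  also have "\<dots> = \<bar>x\<bar> - regret_potential s v m3 m4 0 x"
  proof -
    have "x^2 = (s * u)^2" "x^4 = (s * u)^4"
      using u by (metis power2_abs, metis power_even_abs_numeral even_numeral)
    then show ?thesis
      unfolding regret_potential_def u(2) using assms
      by (simp add: field_simps power2_eq_square power3_eq_cube power4_eq_xxxx)
  qed
  finally show ?thesis by simp
qed

text \<open>Averaging over one further independent step turns powers of the step into moments: the
  linear term vanishes by centring, and the others raise \<open>k\<close> by one.\<close>

lemma sum_regret_potential:
  fixes p d :: "'z \<Rightarrow> real"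
  assumes "sum p W = 1" "(\<Sum>z\<in>W. p z * d z) = 0"
    and "(\<Sum>z\<in>W. p z * d z ^ 2) = v" "(\<Sum>z\<in>W. p z * d z ^ 3) = m3"
    and "(\<Sum>z\<in>W. p z * d z ^ 4) = m4"
  shows "(\<Sum>z\<in>W. p z * regret_potential s v m3 m4 k (x + d z))
           = regret_potential s v m3 m4 (Suc k) x"
proof -
  \<comment> \<open>Taylor coefficients at \<open>x\<close> of the quartic
    \<open>regret_potential s v m3 m4 k\<close>.\<close>
  define c0 c1 c2 c3 c4 where
    "c0 = regret_potential s v m3 m4 k x" and
    "c1 = 2 * x / s - (4 * x^3 + 12 * x * real k * v + 4 * real k * m3) / (4 * s^3)" and
    "c2 = 1 / s - (6 * x^2 + 6 * real k * v) / (4 * s^3)" and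
    "c3 = - (4 * x) / (4 * s^3)" and "c4 = - 1 / (4 * s^3)"
  have "regret_potential s v m3 m4 k (x + y) = c0 + c1 * y + c2 * y^2 + c3 * y^3 + c4 * y^4" for y
  proof -
    have 2: "(x + y)^2 = x^2 + 2 * x * y + y^2"
      by (simp add: power2_eq_square algebra_simps)
    have 4: "(x + y)^4 = x^4 + 4 * x^3 * y + 6 * x^2 * y^2 + 4 * x * y^3 + y^4"
      by (simp add: power2_eq_square power3_eq_cube power4_eq_xxxx algebra_simps)
    show ?thesis
      unfolding regret_potential_def c0_def c1_def c2_def c3_def c4_def 2 4
      by (simp add: add_divide_distrib diff_divide_distrib algebra_simps)
  qed
  then have "p z * regret_potential s v m3 m4 k (x + d z)
     = c0 * p z + c1 * (p z * d z) + c2 * (p z * d z ^ 2) + c3 * (p z * d z ^ 3)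
           + c4 * (p z * d z ^ 4)" for z
    by (simp add: distrib_left)
  then have "(\<Sum>z\<in>W. p z * regret_potential s v m3 m4 k (x + d z))
     = (\<Sum>z\<in>W. c0 * p z + c1 * (p z * d z) + c2 * (p z * d z ^ 2) + c3 * (p z * d z ^ 3)
           + c4 * (p z * d z ^ 4))"
    by simp
  also have "\<dots> = c0 + c2 * v + c3 * m3 + c4 * m4"
    unfolding sum.distrib sum_distrib_left[symmetric] assms by simp
  also have "\<dots> = regret_potential s v m3 m4 (Suc k) x"
    unfolding regret_potential_def c0_def c2_def c3_def c4_def
    by (simp add: add_divide_distrib diff_divide_distrib algebra_simps power2_eq_square)
  finally show ?thesis .
qed

section \<open>The lower bound of order \<open>sqrt T\<close>\<close>

text \<open>
  The adversary draws every move from \<open>p\<close>; the potential keeps track of how far the cumulative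
  losses of the two comparators \<open>f1\<close> and \<open>f2\<close> have drifted apart.
\<close>

lemma game_value_ge_regret_potential:
  fixes l :: "'z \<Rightarrow> 'f \<Rightarrow> real" and p :: "'z \<Rightarrow> real"
  defines "d \<equiv> \<lambda>f1 f2 z. l z f1 - l z f2"
  assumes "F \<noteq> {}" and B: "\<And>z f. z \<in> Z \<Longrightarrow> f \<in> F \<Longrightarrow> \<bar>l z f\<bar> \<le> B"
    and W: "W \<subseteq> Z" "W \<noteq> {}" and p: "\<And>z. z \<in> W \<Longrightarrow> p z \<ge> 0" "sum p W = 1"
    and f: "f1 \<in> F" "f2 \<in> F"
    and min1: "\<And>f. f \<in> F \<Longrightarrow> (\<Sum>z\<in>W. p z * l z f1) \<le> (\<Sum>z\<in>W. p z * l z f)"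
    and min2: "\<And>f. f \<in> F \<Longrightarrow> (\<Sum>z\<in>W. p z * l z f2) \<le> (\<Sum>z\<in>W. p z * l z f)"
    and "s > 0" and "set h \<subseteq> Z \<times> F"
  shows "(\<Sum>(z, f)\<leftarrow>h. l z f - (l z f1 + l z f2) / 2)
      + regret_potential s (\<Sum>z\<in>W. p z * d f1 f2 z ^ 2) (\<Sum>z\<in>W. p z * d f1 f2 z ^ 3)
          (\<Sum>z\<in>W. p z * d f1 f2 z ^ 4) k (\<Sum>(z, _)\<leftarrow>h. d f1 f2 z) / 2
    \<le> game_value l Z F k h"
  using \<open>set h \<subseteq> Z \<times> F\<close>
proof (induction k arbitrary: h)
  case 0
  let ?S = "\<lambda>f. \<Sum>(z, _)\<leftarrow>h. l z f"
  have bdd: "bdd_below (?S ` F)"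
  proof (rule bdd_belowI2)
    fix f assume "f \<in> F"
    have "\<bar>?S f\<bar> \<le> B * real (length h)"
      using 0 B \<open>f \<in> F\<close> by (intro abs_sum_list_le) auto
    then show "- (B * real (length h)) \<le> ?S f" by linarith
  qed
  have INF: "(INF f\<in>F. ?S f) \<le> ?S f1" "(INF f\<in>F. ?S f) \<le> ?S f2"
    using bdd f by (auto intro: cINF_lower)
  have D: "(\<Sum>(z, _)\<leftarrow>h. d f1 f2 z) = ?S f1 - ?S f2"
    unfolding d_def by (induction h) (auto simp: split_def)
  have A: "(\<Sum>(z, f)\<leftarrow>h. l z f - (l z f1 + l z f2) / 2)
      = (\<Sum>(z, f)\<leftarrow>h. l z f) - (?S f1 + ?S f2) / 2"
    by (induction h) (auto simp: split_def field_simps)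
  have "regret_potential s (\<Sum>z\<in>W. p z * d f1 f2 z ^ 2) (\<Sum>z\<in>W. p z * d f1 f2 z ^ 3)
      (\<Sum>z\<in>W. p z * d f1 f2 z ^ 4) 0 (?S f1 - ?S f2) \<le> \<bar>?S f1 - ?S f2\<bar>"
    using \<open>s > 0\<close> by (rule regret_potential_0_le_abs)
  \<comment> \<open>The infimum is at most the smaller of the two comparator losses, which is their
    mean minus half of their distance.\<close>
  moreover have "u - (a + b) / 2 + r / 2 \<le> u - i" if "i \<le> a" "i \<le> b" "r \<le> \<bar>a - b\<bar>"
    for u a b r i :: real
    using that by (cases "a \<le> b") (auto simp: field_simps)
  ultimately show ?case
    unfolding game_value.simps A D using INF by blast
next
  case (Suc k)
  define R where "R = regret_potential s (\<Sum>z\<in>W. p z * d f1 f2 z ^ 2)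
    (\<Sum>z\<in>W. p z * d f1 f2 z ^ 3) (\<Sum>z\<in>W. p z * d f1 f2 z ^ 4)"
  define A where "A = (\<Sum>(z, f)\<leftarrow>h. l z f - (l z f1 + l z f2) / 2)"
  define D where "D = (\<Sum>(z, _)\<leftarrow>h. d f1 f2 z)"
  \<comment> \<open>Two minimisers have the same expected loss, so the steps of the walk are
    centred.\<close>
  have eq12: "(\<Sum>z\<in>W. p z * l z f1) = (\<Sum>z\<in>W. p z * l z f2)"
    using min1[OF f(2)] min2[OF f(1)] by simp
  then have d0: "(\<Sum>z\<in>W. p z * d f1 f2 z) = 0"
    unfolding d_def by (simp add: right_diff_distrib sum_subtractf)
  have "A + R (Suc k) D / 2 \<le> (SUP z\<in>Z. game_value l Z F k (h @ [(z, f)]))" if "f \<in> F" for f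
  proof -
    let ?g = "\<lambda>z. game_value l Z F k (h @ [(z, f)])"
    have "?g z \<le> 2 * B * (real (length (h @ [(z, f)])) + real k)" if "z \<in> Z" for z
      using abs_game_value_le[of Z F l B "h @ [(z, f)]" k] B W \<open>F \<noteq> {}\<close> Suc.prems that \<open>f \<in> F\<close>
      by fastforce
    then have bdd: "bdd_above (?g ` Z)" by (intro bdd_aboveI2) auto
    \<comment> \<open>Whatever \<open>f\<close> is played, its expected loss is at least that of
      \<open>f1\<close>, so the added bracket is nonnegative. The supremum over moves then dominates
      the average with weights \<open>p\<close>.\<close>
    have "A + R (Suc k) D / 2
        \<le> A + R (Suc k) D / 2 + ((\<Sum>z\<in>W. p z * l z f) - (\<Sum>z\<in>W. p z * l z f1))"
      using min1[OF that] by simp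
    also have "\<dots> = (\<Sum>z\<in>W. p z * A + p z * l z f - (p z * l z f1 + p z * l z f2) / 2
        + p z * R k (D + d f1 f2 z) / 2)"
      unfolding sum.distrib sum_subtractf sum_distrib_right[symmetric]
        sum_divide_distrib[symmetric] p(2)
      using sum_regret_potential[OF p(2) d0 refl refl refl, of s k D] eq12
      by (simp add: R_def)
    also have "\<dots> = (\<Sum>z\<in>W. p z * ((A + (l z f - (l z f1 + l z f2) / 2)) + R k (D + d f1 f2 z) / 2))"
      by (intro sum.cong) (auto simp: algebra_simps add_divide_distrib)
    also have "\<dots> \<le> (\<Sum>z\<in>W. p z * ?g z)"
    proof (intro sum_mono mult_left_mono p)
      fix z assume "z \<in> W"
      then show "(A + (l z f - (l z f1 + l z f2) / 2)) + R k (D + d f1 f2 z) / 2 \<le> ?g z"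
        using Suc.IH[of "h @ [(z, f)]"] Suc.prems W that by (auto simp: A_def D_def R_def)
    qed
    also have "\<dots> \<le> (\<Sum>z\<in>W. p z * (SUP z\<in>Z. ?g z))"
      using bdd W by (intro sum_mono mult_left_mono p cSUP_upper) auto
    also have "\<dots> = (SUP z\<in>Z. ?g z)"
      unfolding sum_distrib_right[symmetric] p(2) by simp
    finally show ?thesis .
  qed
  then show ?case
    unfolding A_def R_def D_def game_value.simps
    by (intro cINF_greatest \<open>F \<noteq> {}\<close>) auto
qed

lemma minimax_regret_ge_sqrt:
  fixes l :: "'z \<Rightarrow> 'f \<Rightarrow> real" and p :: "'z \<Rightarrow> real"
  assumes "F \<noteq> {}" and B: "\<And>z f. z \<in> Z \<Longrightarrow> f \<in> F \<Longrightarrow> \<bar>l z f\<bar> \<le> B"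
    and W: "finite W" "W \<subseteq> Z" and p: "\<And>z. z \<in> W \<Longrightarrow> p z > 0"
    and f: "f1 \<in> F" "f2 \<in> F"
    and min1: "\<And>f. f \<in> F \<Longrightarrow> (\<Sum>z\<in>W. p z * l z f1) \<le> (\<Sum>z\<in>W. p z * l z f)"
    and min2: "\<And>f. f \<in> F \<Longrightarrow> (\<Sum>z\<in>W. p z * l z f2) \<le> (\<Sum>z\<in>W. p z * l z f)"
    and w: "w \<in> W" "l w f1 \<noteq> l w f2"
  shows "\<exists>a>0. \<forall>T\<ge>1. minimax_regret l Z F T \<ge> a * sqrt (real T)"
proof -
  \<comment> \<open>Normalising the weights to a probability vector does not change the
    minimisers.\<close>
  define P where "P = sum p W"
  have "P > 0" unfolding P_def using W w p by (intro sum_pos) auto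
  define q where "q z = p z / P" for z
  have q: "q z > 0" if "z \<in> W" for z using p[OF that] \<open>P > 0\<close> by (simp add: q_def)
  have q1: "sum q W = 1"
    using \<open>P > 0\<close> by (simp add: q_def[abs_def] sum_divide_distrib[symmetric] P_def[symmetric])
  have qsum: "(\<Sum>z\<in>W. q z * l z f) = (\<Sum>z\<in>W. p z * l z f) / P" for f
    by (simp add: q_def sum_divide_distrib)
  define d where "d z = l z f1 - l z f2" for z
  define v m3 m4 where "v = (\<Sum>z\<in>W. q z * d z ^ 2)" and "m3 = (\<Sum>z\<in>W. q z * d z ^ 3)"
    and "m4 = (\<Sum>z\<in>W. q z * d z ^ 4)"
  define b where "b = 2 * B"
  have d_le: "\<bar>d z\<bar> \<le> b" if "z \<in> W" for z
    using B[of z f1] B[of z f2] that W f by (auto simp: d_def b_def)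
  have "b > 0" using d_le[OF w(1)] w(2) by (auto simp: d_def)
  have d2: "d z ^ 2 \<le> b ^ 2" if "z \<in> W" for z
    using d_le[OF that] by (metis abs_ge_zero power2_abs power_mono)
  have "v > 0"
    unfolding v_def using W w q
    by (intro sum_pos2[of W w]) (auto simp: d_def less_imp_le)
  have "v \<le> (\<Sum>z\<in>W. q z * b ^ 2)"
    unfolding v_def using d2 q by (intro sum_mono mult_left_mono) (auto simp: less_imp_le)
  then have v_le: "v \<le> b ^ 2" by (simp add: sum_distrib_right[symmetric] q1)
  have "m4 \<le> (\<Sum>z\<in>W. b ^ 2 * (q z * d z ^ 2))"
    unfolding m4_def
  proof (intro sum_mono)
    fix z assume "z \<in> W"
    have "q z * d z ^ 2 * d z ^ 2 \<le> q z * d z ^ 2 * b ^ 2"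
      using d2 q \<open>z \<in> W\<close> by (intro mult_left_mono) (auto simp: less_imp_le)
    then show "q z * d z ^ 4 \<le> b ^ 2 * (q z * d z ^ 2)"
      by (simp add: power4_eq_xxxx power2_eq_square algebra_simps)
  qed
  then have m4_le: "m4 \<le> b ^ 2 * v" by (simp add: v_def sum_distrib_left)
  \<comment> \<open>The scale \<open>s = b * t\<close> matches the size of the walk after
    \<open>T\<close> steps. The quadratic part is then \<open>t * v / b\<close>, the quartic part at
    most three quarters of it; the remaining quarter is halved by the factor in front of the
    potential.\<close>
  have "v / (8 * b) * sqrt (real T) \<le> minimax_regret l Z F T" if "T \<ge> 1" for T
  proof -
    define t where "t = sqrt (real T)"
    have t: "t \<ge> 1" "real T = t ^ 2" using that by (auto simp: t_def)
    have "regret_potential (b * t) v m3 m4 T 0 / 2 \<le> minimax_regret l Z F T"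
      using game_value_ge_regret_potential[of F Z l B W q f1 f2 "b * t" "[]" T]
        \<open>F \<noteq> {}\<close> B W w f q q1 min1 min2 \<open>b > 0\<close> \<open>P > 0\<close> t
      by (auto simp: minimax_regret_def v_def m3_def m4_def d_def qsum less_imp_le divide_right_mono)
    moreover have "v / (4 * b) * t \<le> regret_potential (b * t) v m3 m4 T 0"
    proof -
      have "v ^ 2 \<le> b ^ 2 * v"
        using v_le \<open>v > 0\<close> by (simp add: power2_eq_square)
      \<comment> \<open>Here \<open>T \<ge> 1\<close> matters: it makes the factor
        \<open>t^2 - 1\<close> nonnegative.\<close>
      then have "t^2 * m4 + 3 * t^2 * (t^2 - 1) * v^2
          \<le> t^2 * (b^2 * v) + 3 * t^2 * (t^2 - 1) * (b^2 * v)"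
        using m4_le t by (intro add_mono mult_left_mono) auto
      also have "\<dots> = 3 * t^4 * b^2 * v - 2 * t^2 * b^2 * v"
        by (simp add: power2_eq_square power4_eq_xxxx algebra_simps)
      also have "\<dots> \<le> 3 * t^4 * b^2 * v" using \<open>v > 0\<close> by simp
      finally have "(t^2 * m4 + 3 * t^2 * (t^2 - 1) * v^2) / (4 * (b * t)^3)
          \<le> 3 * t^4 * b^2 * v / (4 * (b * t)^3)"
        using \<open>b > 0\<close> t by (intro divide_right_mono) auto
      moreover have "v / (4 * b) * t = t^2 * v / (b * t) - 3 * t^4 * b^2 * v / (4 * (b * t)^3)"
        using \<open>b > 0\<close> t by (simp add: field_simps power2_eq_square power3_eq_cube power4_eq_xxxx)
      ultimately show ?thesis
        unfolding regret_potential_def t(2) by simp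
    qed
    ultimately show ?thesis by (simp add: t_def)
  qed
  moreover have "v / (8 * b) > 0" using \<open>v > 0\<close> \<open>b > 0\<close> by simp
  ultimately show ?thesis by blast
qed

section \<open>A common minimiser for finitely many moves\<close>

text \<open>A segment of weights is not the union of two disjoint non-empty closed sets, so a point
  optimal for one positive weight vector is optimal for all. Weights stay positive throughout, since
  \<open>uniq\<close> applies only to those; single losses are reached as limits.\<close>

lemma common_minimizer_if_unique_losses:
  fixes l :: "'z \<Rightarrow> 'f \<Rightarrow> real"
  assumes W: "finite W" and "finite S" "S \<subseteq> F"
    and S: "\<And>p. (\<And>z. z \<in> W \<Longrightarrow> p z > 0) \<Longrightarrow>
      \<exists>s\<in>S. \<forall>f\<in>F. (\<Sum>z\<in>W. p z * l z s) \<le> (\<Sum>z\<in>W. p z * l z f)"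
    and uniq: "\<And>p f1 f2 z. \<lbrakk>\<And>z. z \<in> W \<Longrightarrow> p z > 0; f1 \<in> F; f2 \<in> F;
      \<And>f. f \<in> F \<Longrightarrow> (\<Sum>z\<in>W. p z * l z f1) \<le> (\<Sum>z\<in>W. p z * l z f);
      \<And>f. f \<in> F \<Longrightarrow> (\<Sum>z\<in>W. p z * l z f2) \<le> (\<Sum>z\<in>W. p z * l z f); z \<in> W\<rbrakk>
      \<Longrightarrow> l z f1 = l z f2"
  shows "\<exists>s\<in>F. \<forall>z\<in>W. \<forall>f\<in>F. l z s \<le> l z f"
proof -
  define L where "L p f = (\<Sum>z\<in>W. p z * l z f)" for p f
  define opt where "opt p s \<longleftrightarrow> (\<forall>f\<in>F. L p s \<le> L p f)" for p s
  obtain s0 where s0: "s0 \<in> S" "opt (\<lambda>_. 1) s0"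
    using S[of "\<lambda>_. 1"] by (auto simp: opt_def L_def)
  have opt_s0: "opt p s0" if p: "\<And>z. z \<in> W \<Longrightarrow> p z > 0" for p
  proof -
    \<comment> \<open>A path from the constant weights, where \<open>s0\<close> is optimal, to
      \<open>p\<close>.\<close>
    define r where "r t z = (1 - t) * 1 + t * p z" for t z
    define Q where "Q s = {t \<in> {0..1}. opt (r t) s}" for s
    have r: "r t z > 0" if "t \<in> {0..1}" "z \<in> W" for t z
    proof (cases "t = 1")
      case False
      then show ?thesis using p[OF that(2)] that(1) unfolding r_def by (intro add_pos_nonneg) auto
    qed (use p that in \<open>simp add: r_def\<close>)
    have closedQ: "closed (Q s)" for s
    proof -
      have "Q s = {0..1} \<inter> (\<Inter>f\<in>F. {t. L (r t) s \<le> L (r t) f})"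
        by (auto simp: Q_def opt_def)
      moreover have "closed {t. L (r t) s \<le> L (r t) f}" for f
        unfolding L_def r_def by (intro closed_Collect_le continuous_intros)
      ultimately show ?thesis by (simp add: closed_Int closed_INT)
    qed
    \<comment> \<open>By \<open>uniq\<close>, no point of \<open>E\<close> is optimal together with
      \<open>s0\<close>. An optimal point of \<open>S\<close> outside \<open>E\<close> has the
      losses of \<open>s0\<close>, so \<open>s0\<close> is optimal as well.\<close>
    define E where "E = {s \<in> S. \<exists>z\<in>W. l z s \<noteq> l z s0}"
    have "Q s0 \<inter> (\<Union>s\<in>E. Q s) \<inter> {0..1} = {}"
    proof -
      have False if "t \<in> Q s0" "t \<in> Q s" "s \<in> E" for t s
        using that uniq[of "r t" s s0] r[of t] s0 \<open>S \<subseteq> F\<close>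
        unfolding Q_def E_def opt_def L_def by blast
      then show ?thesis by blast
    qed
    moreover have "{0..1} \<subseteq> Q s0 \<union> (\<Union>s\<in>E. Q s)"
    proof
      fix t :: real assume t: "t \<in> {0..1}"
      obtain s where s: "s \<in> S" "opt (r t) s"
        using S[of "r t"] r[OF t] by (auto simp: opt_def L_def)
      show "t \<in> Q s0 \<union> (\<Union>s\<in>E. Q s)"
      proof (cases "s \<in> E")
        case False
        then have "L (r t) s = L (r t) s0"
          unfolding L_def using s(1) by (intro sum.cong) (auto simp: E_def)
        then show ?thesis using s t by (auto simp: Q_def opt_def)
      qed (use s t in \<open>auto simp: Q_def\<close>)
    qed
    moreover have "closed (\<Union>s\<in>E. Q s)"
      using closedQ \<open>finite S\<close> by (intro closed_UN) (auto simp: E_def)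
    moreover have "(0::real) \<in> Q s0"
      using s0(2) by (simp add: Q_def r_def[abs_def])
    ultimately have "(\<Union>s\<in>E. Q s) \<inter> {0..1} = {}"
      using closedQ[of s0] connected_Icc[of "0::real" 1] unfolding connected_closed
      by (smt (verit) Int_emptyI Int_iff atLeastAtMost_iff disjoint_iff zero_le_one)
    moreover have "(1::real) \<in> {0..1}" by simp
    ultimately have "1 \<in> Q s0"
      using \<open>{0..1} \<subseteq> Q s0 \<union> (\<Union>s\<in>E. Q s)\<close> by blast
    then show ?thesis by (simp add: Q_def r_def[abs_def])
  qed
  have "l z s0 \<le> l z f" if z: "z \<in> W" and f: "f \<in> F" for z f
  proof -
    \<comment> \<open>Move \<open>z\<close> gets weight 1 and every other move weight
      \<open>e\<close>; letting \<open>e\<close> tend to 0 from the right isolates the loss at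
      \<open>z\<close>.\<close>
    define K where "K g = (\<Sum>y\<in>W - {z}. l y g)" for g
    have L_eq: "L (\<lambda>y. if y = z then 1 else e) g = l z g + e * K g" for e g
      unfolding L_def K_def sum.remove[OF W z] sum_distrib_left by (auto intro!: sum.cong)
    have ineq: "l z s0 + e * K s0 \<le> l z f + e * K f" if "e > 0" for e
      using opt_s0[of "\<lambda>y. if y = z then 1 else e"] that f by (auto simp: opt_def L_eq)
    have "((\<lambda>e. l z s0 + e * K s0) \<longlongrightarrow> l z s0 + 0 * K s0) (at_right 0)"
      "((\<lambda>e. l z f + e * K f) \<longlongrightarrow> l z f + 0 * K f) (at_right 0)"
      by (intro tendsto_intros)+
    moreover have "\<forall>\<^sub>F e in at_right 0. l z s0 + e * K s0 \<le> l z f + e * K f"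
      using ineq by (auto simp: eventually_at_right_field intro!: exI[of _ 1])
    ultimately show ?thesis
      using tendsto_le[of "at_right (0::real)"] by fastforce
  qed
  then show ?thesis using s0 \<open>S \<subseteq> F\<close> by auto
qed

section \<open>Reduction to finite sets by polyhedral geometry\<close>

text \<open>The maximisers of a linear functional form a face, and a polyhedron has finitely many
  faces, so one point from each non-empty face suffices. Vertices would not do: an unbounded
  polyhedron may have none.\<close>

lemma polyhedron_finite_maximizers:
  fixes X :: "'a::euclidean_space set"
  assumes "polyhedron X"
  obtains Y where "finite Y" "Y \<subseteq> X"
    "\<And>w m. is_maximum ((\<lambda>x. w \<bullet> x) ` X) m \<Longrightarrow> is_maximum ((\<lambda>x. w \<bullet> x) ` Y) m"
proof
  define Y where "Y = (\<lambda>G. SOME x. x \<in> G) ` {G. G face_of X \<and> G \<noteq> {}}"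
  show "finite Y"
    unfolding Y_def using finite_polyhedron_faces[OF assms] by (auto intro: finite_subset)
  have in_face: "(SOME x. x \<in> G) \<in> G" if "G \<noteq> {}" for G :: "'a set"
    using that by (simp add: some_in_eq)
  show "Y \<subseteq> X"
    unfolding Y_def using in_face face_of_imp_subset by blast
  fix w m assume max: "is_maximum ((\<lambda>x. w \<bullet> x) ` X) m"
  let ?G = "X \<inter> {x. w \<bullet> x = m}"
  have "?G face_of X"
    using max by (intro face_of_Int_supporting_hyperplane_le polyhedron_imp_convex assms)
      (auto simp: is_maximum_def)
  moreover have "?G \<noteq> {}" using max by (auto simp: is_maximum_def)
  ultimately have "(SOME x. x \<in> ?G) \<in> Y" "w \<bullet> (SOME x. x \<in> ?G) = m"
    using in_face[of ?G] unfolding Y_def by blast+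
  then show "is_maximum ((\<lambda>x. w \<bullet> x) ` Y) m"
    using max \<open>Y \<subseteq> X\<close> unfolding is_maximum_def by (auto intro: rev_image_eqI)
qed

text \<open>Otherwise an open halfspace missing \<open>f\<close> would contain all extreme points
  and hence, by Krein-Milman, their hull \<open>D\<close>.\<close>

lemma linear_min_at_extreme_point:
  fixes D :: "'a::euclidean_space set"
  assumes "compact D" "convex D" "f \<in> D"
  shows "\<exists>s. s extreme_point_of D \<and> a \<bullet> s \<le> a \<bullet> f"
proof (rule ccontr)
  assume "\<not> ?thesis"
  then have "{s. s extreme_point_of D} \<subseteq> {x. a \<bullet> x > a \<bullet> f}" by auto
  then have "convex hull {s. s extreme_point_of D} \<subseteq> {x. a \<bullet> x > a \<bullet> f}"
    by (rule hull_minimal) (rule convex_halfspace_gt)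
  with Krein_Milman_Minkowski[OF assms(1,2)] \<open>f \<in> D\<close> show False by auto
qed

text \<open>
  On a cell of \<open>F\<close> where the maximiser \<open>\<sigma> z\<close> is fixed for every \<open>z\<close>, all weighted losses are
  affine; the vertices of these cells form the finite set.
\<close>

lemma finite_minimizers:
  fixes F :: "(real ^ 'n) set" and C :: "'z \<Rightarrow> real ^ 'n ^ 'd"
  assumes "F \<noteq> {}" "compact F" "polyhedron F" and W: "finite W"
    and Y: "\<And>z. z \<in> W \<Longrightarrow> finite (Y z)"
    and max: "\<And>z f. z \<in> W \<Longrightarrow> f \<in> F \<Longrightarrow> is_maximum ((\<lambda>x. (C z *v f + c z) \<bullet> x) ` Y z) (l z f)"
  obtains S where "finite S" "S \<subseteq> F"
    "\<And>p. \<exists>s\<in>S. \<forall>f\<in>F. (\<Sum>z\<in>W. p z * l z s) \<le> (\<Sum>z\<in>W. p z * l z f)"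
proof
  define D where "D \<sigma> = F \<inter> (\<Inter>z\<in>W. \<Inter>y\<in>Y z.
    {f. (C z *v f + c z) \<bullet> y \<le> (C z *v f + c z) \<bullet> \<sigma> z})" for \<sigma>
  \<comment> \<open>The cells do not involve \<open>p\<close>, so one set serves all weights. Taking
    choice functions in \<open>Pi\<^sub>E W Y\<close> leaves only finitely many cells.\<close>
  define S where "S = (\<Union>\<sigma>\<in>Pi\<^sub>E W Y. {s. s extreme_point_of D \<sigma>})"
  have dot: "(C z *v f + c z) \<bullet> y = (y v* C z) \<bullet> f + c z \<bullet> y" for z f y
    using dot_lmul_matrix[of y "C z" f] by (simp add: inner_add_right inner_commute)
  have poly: "polyhedron (D \<sigma>)" for \<sigma>
  proof -
    have "{f. (C z *v f + c z) \<bullet> y \<le> (C z *v f + c z) \<bullet> \<sigma> z}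
        = {f. (y v* C z - \<sigma> z v* C z) \<bullet> f \<le> c z \<bullet> \<sigma> z - c z \<bullet> y}" for z y
      unfolding dot by (auto simp: inner_diff_left)
    then have "polyhedron {f. (C z *v f + c z) \<bullet> y \<le> (C z *v f + c z) \<bullet> \<sigma> z}" for z y
      by (simp add: polyhedron_halfspace_le)
    then show ?thesis
      unfolding D_def using W Y \<open>polyhedron F\<close>
      by (intro polyhedron_Int polyhedron_Inter) auto
  qed
  have compD: "compact (D \<sigma>)" for \<sigma>
    using compact_Int_closed[OF \<open>compact F\<close> polyhedron_imp_closed[OF poly[of \<sigma>]]]
    by (simp add: D_def flip: Int_assoc)
  show "finite S"
    unfolding S_def using W Y poly
    by (intro finite_UN_I finite_PiE finite_polyhedron_extreme_points) auto
  show "S \<subseteq> F"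
    by (auto simp: S_def D_def extreme_point_of_def)
  fix p :: "'z \<Rightarrow> real"
  let ?L = "\<lambda>f. \<Sum>z\<in>W. p z * l z f"
  have L: "\<exists>s\<in>S. ?L s \<le> ?L f" if f: "f \<in> F" for f
  proof -
    \<comment> \<open>The maximisers active at \<open>f\<close> select a cell that contains
      \<open>f\<close>.\<close>
    have "\<forall>z\<in>W. \<exists>y\<in>Y z. (C z *v f + c z) \<bullet> y = l z f"
      using max f unfolding is_maximum_def by fastforce
    then obtain \<tau> where \<tau>: "\<And>z. z \<in> W \<Longrightarrow> \<tau> z \<in> Y z \<and> (C z *v f + c z) \<bullet> \<tau> z = l z f"
      by metis
    define \<sigma> where "\<sigma> = restrict \<tau> W"
    have \<sigma>: "\<sigma> \<in> Pi\<^sub>E W Y" using \<tau> by (auto simp: \<sigma>_def)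
    have "f \<in> D \<sigma>"
      using f \<tau> max unfolding D_def \<sigma>_def is_maximum_def by auto
    define a b where "a = (\<Sum>z\<in>W. p z *\<^sub>R (\<sigma> z v* C z))" and "b = (\<Sum>z\<in>W. p z * (c z \<bullet> \<sigma> z))"
    have L_eq: "?L g = a \<bullet> g + b" if g: "g \<in> D \<sigma>" for g
    proof -
      have "l z g = (C z *v g + c z) \<bullet> \<sigma> z" if z: "z \<in> W" for z
      proof (rule antisym)
        show "l z g \<le> (C z *v g + c z) \<bullet> \<sigma> z"
          using max[OF z, of g] g z by (auto simp: D_def is_maximum_def)
        show "(C z *v g + c z) \<bullet> \<sigma> z \<le> l z g"
          using max[OF z, of g] g z \<sigma> by (auto simp: D_def is_maximum_def PiE_iff)
      qed
      then show ?thesis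
        by (simp add: dot a_def b_def inner_sum_left sum.distrib distrib_left)
    qed
    obtain s where s: "s extreme_point_of D \<sigma>" "a \<bullet> s \<le> a \<bullet> f"
      using linear_min_at_extreme_point compD polyhedron_imp_convex[OF poly] \<open>f \<in> D \<sigma>\<close> by blast
    then have "?L s \<le> ?L f"
      using L_eq[of s] L_eq[OF \<open>f \<in> D \<sigma>\<close>] by (simp add: extreme_point_of_def)
    then show ?thesis using s \<sigma> by (auto simp: S_def)
  qed
  have "S \<noteq> {}" using L \<open>F \<noteq> {}\<close> by blast
  then have s: "arg_min_on ?L S \<in> S" "\<And>s'. s' \<in> S \<Longrightarrow> ?L (arg_min_on ?L S) \<le> ?L s'"
    using arg_min_if_finite(1)[of S ?L] arg_min_least[of S _ ?L] \<open>finite S\<close> by auto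
  show "\<exists>s\<in>S. \<forall>f\<in>F. ?L s \<le> ?L f"
  proof (intro bexI ballI)
    fix f assume "f \<in> F"
    then obtain s' where "s' \<in> S" "?L s' \<le> ?L f" using L by blast
    then show "?L (arg_min_on ?L S) \<le> ?L f" using s(2)[of s'] by linarith
  qed (rule s(1))
qed

section \<open>Compactness and the dichotomy\<close>

text \<open>The minimisers of each loss form a closed sublevel set, and \<open>fin\<close> gives
  these sets the finite intersection property inside the compact \<open>F\<close>.\<close>

lemma trivial_game_if_finitely_trivial:
  fixes F :: "'f::heine_borel set" and l :: "'z \<Rightarrow> 'f \<Rightarrow> real"
  assumes "F \<noteq> {}" "compact F"
    and closed: "\<And>z m. z \<in> Z \<Longrightarrow> closed {f \<in> F. l z f \<le> m}"
    and fin: "\<And>W. finite W \<Longrightarrow> W \<subseteq> Z \<Longrightarrow> \<exists>s\<in>F. \<forall>z\<in>W. \<forall>f\<in>F. l z s \<le> l z f"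
  shows "trivial_game l Z F"
proof -
  define M where "M z = {s \<in> F. l z s \<le> (INF f\<in>F. l z f)}" for z
  have "F \<inter> (\<Inter>z\<in>Z. M z) \<noteq> {}"
  proof (rule compact_imp_fip_image[OF \<open>compact F\<close>])
    show "closed (M z)" if "z \<in> Z" for z
      unfolding M_def using closed[OF that] .
    show "F \<inter> (\<Inter>z\<in>W. M z) \<noteq> {}" if "finite W" "W \<subseteq> Z" for W
    proof -
      obtain s where "s \<in> F" "\<forall>z\<in>W. \<forall>f\<in>F. l z s \<le> l z f" using fin \<open>finite W\<close> \<open>W \<subseteq> Z\<close> by metis
      then have "\<forall>z\<in>W. s \<in> M z"
        unfolding M_def using \<open>F \<noteq> {}\<close> by (auto intro: cINF_greatest)
      then show ?thesis using \<open>s \<in> F\<close> by blast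
    qed
  qed
  then show ?thesis unfolding trivial_game_def M_def by blast
qed

theorem theorem2:
  fixes Z :: "(real ^ 'dz) set"
    and F :: "(real ^ 'df) set"
    and l :: "real ^ 'dz \<Rightarrow> real ^ 'df \<Rightarrow> real"
    and C :: "real ^ 'dz \<Rightarrow> real ^ 'df ^ 'd"
    and c :: "real ^ 'dz \<Rightarrow> real ^ 'd"
    and X :: "real ^ 'dz \<Rightarrow> (real ^ 'd) set"
  assumes "Z \<noteq> {}" and "compact Z"
    and "F \<noteq> {}" and "convex F" and "compact F"
    and "\<exists>B. \<forall>z\<in>Z. \<forall>f\<in>F. \<bar>l z f\<bar> \<le> B"
    and "\<And>z. z \<in> Z \<Longrightarrow> X z \<noteq> {}"
    and "\<And>z. z \<in> Z \<Longrightarrow> finite (X z) \<or> polyhedron (X z)"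
    and "\<And>z f. z \<in> Z \<Longrightarrow> f \<in> F \<Longrightarrow>
           is_maximum ((\<lambda>x. (C z *v f + c z) \<bullet> x) ` X z) (l z f)"
    and "polyhedron F"
    and "finite Z \<or> (\<forall>f\<in>F. continuous_on Z (\<lambda>z. l z f))"
  shows "trivial_game l Z F \<or>
    (\<exists>a>0. \<exists>T0::nat. \<forall>T\<ge>T0. minimax_regret l Z F T \<ge> a * sqrt (real T))"
proof (rule disjCI)
  assume no_rate: "\<not> (\<exists>a>0. \<exists>T0::nat. \<forall>T\<ge>T0. minimax_regret l Z F T \<ge> a * sqrt (real T))"
  obtain B where B: "\<And>z f. z \<in> Z \<Longrightarrow> f \<in> F \<Longrightarrow> \<bar>l z f\<bar> \<le> B" using assms(6) by blast
  \<comment> \<open>A finite \<open>X z\<close> serves as its own \<open>Y\<close>; a polyhedral one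
    is replaced by representatives of its faces.\<close>
  have "\<exists>Y. finite Y \<and> (\<forall>f\<in>F. is_maximum ((\<lambda>x. (C z *v f + c z) \<bullet> x) ` Y) (l z f))"
    if z: "z \<in> Z" for z
    using assms(8)[OF z]
  proof
    assume "finite (X z)"
    then show ?thesis using assms(9)[OF z] by blast
  next
    assume "polyhedron (X z)"
    then show ?thesis using assms(9)[OF z] by (metis polyhedron_finite_maximizers)
  qed
  then obtain Y where Y: "\<And>z. z \<in> Z \<Longrightarrow> finite (Y z)"
    "\<And>z f. z \<in> Z \<Longrightarrow> f \<in> F \<Longrightarrow> is_maximum ((\<lambda>x. (C z *v f + c z) \<bullet> x) ` Y z) (l z f)"
    by metis
  show "trivial_game l Z F"
  proof (rule trivial_game_if_finitely_trivial[OF \<open>F \<noteq> {}\<close> \<open>compact F\<close>])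
    fix z m assume z: "z \<in> Z"
    \<comment> \<open>A maximum of functions affine in \<open>f\<close> has intersections of closed
      sets as sublevel sets.\<close>
    have "{f \<in> F. l z f \<le> m} = F \<inter> (\<Inter>x\<in>X z. {f. (C z *v f + c z) \<bullet> x \<le> m})"
      using assms(9)[OF z] unfolding is_maximum_def by fastforce
    moreover have "closed {f. (C z *v f + c z) \<bullet> x \<le> m}" for x
      by (intro closed_Collect_le continuous_intros matrix_vector_mult_linear_continuous_on)
    ultimately show "closed {f \<in> F. l z f \<le> m}"
      using compact_imp_closed[OF \<open>compact F\<close>] by (auto intro!: closed_Int)
  next
    fix W assume W: "finite W" "W \<subseteq> Z"
    have YW: "finite (Y z)" "\<And>f. f \<in> F \<Longrightarrow> is_maximum ((\<lambda>x. (C z *v f + c z) \<bullet> x) ` Y z) (l z f)"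
      if "z \<in> W" for z
      using Y W(2) that by auto
    obtain S where S: "finite S" "S \<subseteq> F"
      "\<And>p. \<exists>s\<in>S. \<forall>f\<in>F. (\<Sum>z\<in>W. p z * l z s) \<le> (\<Sum>z\<in>W. p z * l z f)"
      by (rule finite_minimizers[where l = l and Y = Y and C = C and c = c,
            OF \<open>F \<noteq> {}\<close> \<open>compact F\<close> \<open>polyhedron F\<close> W(1) YW])
        (assumption+, rule that)
    show "\<exists>s\<in>F. \<forall>z\<in>W. \<forall>f\<in>F. l z s \<le> l z f"
    proof (rule common_minimizer_if_unique_losses[where l = l, OF W(1) S(1,2)])
      show "\<exists>s\<in>S. \<forall>f\<in>F. (\<Sum>z\<in>W. p z * l z s) \<le> (\<Sum>z\<in>W. p z * l z f)"
        for p :: "real ^ 'dz \<Rightarrow> real"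
        using S(3) .
      show "l z f1 = l z f2"
        if "\<And>z. z \<in> W \<Longrightarrow> p z > 0" "f1 \<in> F" "f2 \<in> F"
          "\<And>f. f \<in> F \<Longrightarrow> (\<Sum>z\<in>W. p z * l z f1) \<le> (\<Sum>z\<in>W. p z * l z f)"
          "\<And>f. f \<in> F \<Longrightarrow> (\<Sum>z\<in>W. p z * l z f2) \<le> (\<Sum>z\<in>W. p z * l z f)" "z \<in> W"
        for p :: "real ^ 'dz \<Rightarrow> real" and f1 f2 z
      proof (rule ccontr)
        assume neq: "l z f1 \<noteq> l z f2"
        \<comment> \<open>Two minimisers with different losses would give the excluded rate, with
          \<open>T0 = 1\<close>.\<close>
        have "\<exists>a>0. \<forall>T\<ge>1. minimax_regret l Z F T \<ge> a * sqrt (real T)"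
          by (rule minimax_regret_ge_sqrt[where p = p and w = z and l = l,
                OF \<open>F \<noteq> {}\<close> B W that neq])
        with no_rate show False by metis
      qed
    qed
  qed
qed

end
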